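(* Let $d\ge 1$ and let $S$ be a finite symmetric generating set of $\mathbb{Z}^d$. Let $\beta(n)=\#B_n$ and $\sigma(n)=\#S_n$ be the growth function and the spherical growth function of $(\mathbb{Z}^d,S)$. Then $$\beta(n)=Vn^d+O(n^{d-1}),\qquad \sigma(n)=(d\cdot V)\,n^{d-1}+O(n^{d-2}),$$ where $V=\mathrm{Vol}(Q)$ and $Q$ is the convex hull of $S$ in $\mathbb{R}^d$.
   Context: Symmetric means $S=-S$. The word length $|\mathsf{w}|$ of $\mathsf{w}\in\mathbb{Z}^d$ is the minimal number of elements of $S$ (with repetition) summing to $\mathsf{w}$; $S_n=\{\mathsf{w}\in\mathbb{Z}^d: |\mathsf{w}|=n\}$ and $B_n=\{\mathsf{w}\in\mathbb{Z}^d: |\mathsf{w}|\le n\}$. $\mathrm{Vol}$ is Lebesgue measure on $\mathbb{R}^d\supset\mathbb{Z}^d$. The $O(\cdot)$ is as $n\to\infty$. *)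

theory Defs
  imports
    "HOL-Analysis.Analysis"
    "HOL-Library.Landau_Symbols"
    "HOL-Computational_Algebra.Group_Closure"
begin

text \<open>
  The lattice \<open>\<int>\<^sup>d\<close> is the additive group \<open>int ^ 'd\<close>, with \<open>d = CARD('d)\<close>; index types are
  non-empty, so \<open>d \<ge> 1\<close>.
\<close>

definition symmetric :: "'a::ab_group_add set \<Rightarrow> bool" where
  "symmetric S \<longleftrightarrow> S = uminus ` S"

text \<open>
  Generation is as a group; \<^const>\<open>group_closure\<close> is the additive subgroup generated by a set.
\<close>

definition generating :: "'a::ab_group_add set \<Rightarrow> bool" where
  "generating S \<longleftrightarrow> group_closure S = UNIV"

text \<open>
  If no word over \<open>S\<close> represents \<open>w\<close>, the value is unspecified. For symmetric generating \<open>S\<close> this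
  does not occur.
\<close>

definition word_length :: "'a::ab_group_add set \<Rightarrow> 'a \<Rightarrow> nat" where
  "word_length S w = (LEAST n. \<exists>xs. length xs = n \<and> set xs \<subseteq> S \<and> sum_list xs = w)"

definition word_sphere :: "'a::ab_group_add set \<Rightarrow> nat \<Rightarrow> 'a set" where
  "word_sphere S n = {w. word_length S w = n}"

definition word_ball :: "'a::ab_group_add set \<Rightarrow> nat \<Rightarrow> 'a set" where
  "word_ball S n = {w. word_length S w \<le> n}"

definition growth :: "'a::ab_group_add set \<Rightarrow> nat \<Rightarrow> nat" where
  "growth S n = card (word_ball S n)"

definition spherical_growth :: "'a::ab_group_add set \<Rightarrow> nat \<Rightarrow> nat" where
  "spherical_growth S n = card (word_sphere S n)"

definition real_vec :: "int ^ 'd \<Rightarrow> real ^ 'd" where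
  "real_vec w = (\<chi> i. real_of_int (w $ i))"

end

theory Submission
  imports Defs "HOL-Computational_Algebra.Polynomial" "HOL-Computational_Algebra.Primes"
begin

text \<open>
  The ball \<open>B\<^sub>n\<close> is the \<open>n\<close>-fold sumset of \<open>S \<union> {0}\<close>, so by Khovanskii's theorem \<open>\<beta>\<close> agrees with a
  polynomial for large \<open>n\<close>. Placing unit cubes at lattice points gives
  \<open>V (n - c)\<^sup>d \<le> \<beta>(n) \<le> V (n + c)\<^sup>d\<close>: words of length \<open>n\<close> lie in \<open>n Q\<close>, and conversely a lattice
  point of \<open>n Q\<close> has length at most \<open>n + C\<close>. Hence the polynomial has leading term \<open>V n\<^sup>d\<close>, and
  only because \<open>\<beta>\<close> is a polynomial does its difference \<open>\<sigma>\<close> have an error term of order \<open>n\<^bsup>d-2\<^esup>\<close>.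
\<close>

section \<open>Khovanskii's theorem\<close>

definition eventually_poly :: "(nat \<Rightarrow> real) \<Rightarrow> bool" where
  "eventually_poly f \<longleftrightarrow> (\<exists>p. \<forall>\<^sub>F n in sequentially. f n = poly p (real n))"

lemma eventually_poly_diff:
  assumes "eventually_poly f" "eventually_poly g"
  shows "eventually_poly (\<lambda>n. f n - g n)"
proof -
  obtain p q where "\<forall>\<^sub>F n in sequentially. f n = poly p (real n)"
    "\<forall>\<^sub>F n in sequentially. g n = poly q (real n)"
    using assms unfolding eventually_poly_def by blast
  then have "\<forall>\<^sub>F n in sequentially. f n - g n = poly (p - q) (real n)"
    by eventually_elim simp
  then show ?thesis unfolding eventually_poly_def by blast
qed

lemma eventually_poly_shift:
  assumes "eventually_poly f"
  shows "eventually_poly (\<lambda>n. f (n - m))"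
proof -
  obtain p N where p: "\<And>n. n \<ge> N \<Longrightarrow> f n = poly p (real n)"
    using assms unfolding eventually_poly_def eventually_sequentially by blast
  \<comment> \<open>Beyond \<open>N + m\<close> the natural subtraction is genuine and its result is
    at least \<open>N\<close>.\<close>
  have "f (n - m) = poly (pcompose p [:- real m, 1:]) (real n)" if "n \<ge> N + m" for n
    using p[of "n - m"] that by (simp add: poly_pcompose of_nat_diff)
  then show ?thesis unfolding eventually_poly_def eventually_sequentially by blast
qed

lemma eventually_poly_cong:
  assumes "eventually_poly f" "\<forall>\<^sub>F n in sequentially. f n = g n"
  shows "eventually_poly g"
proof -
  obtain p where "\<forall>\<^sub>F n in sequentially. f n = poly p (real n)"
    using assms(1) unfolding eventually_poly_def by blast
  with assms(2) have "\<forall>\<^sub>F n in sequentially. g n = poly p (real n)"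
    by eventually_elim simp
  then show ?thesis unfolding eventually_poly_def by blast
qed

section \<open>Counting multisets that contain none of finitely many given ones\<close>

lemma eventually_poly_card_multisets_of_size:
  assumes "finite A"
  shows "eventually_poly (\<lambda>n. real (card (multisets_of_size A n)))"
proof (cases "card A")
  case 0
  then have "A = {}" using assms by simp
  \<comment> \<open>At n = 0 the empty multiset is counted, so agreement with the zero polynomial
    starts at 1.\<close>
  then have "real (card (multisets_of_size A n)) = poly 0 (real n)" if "n \<ge> 1" for n
    using that by simp
  then show ?thesis unfolding eventually_poly_def eventually_sequentially by blast
next
  case (Suc k)
  \<comment> \<open>At n this is the product of the n + k - i over i < k, divided by k!, that is
    \<open>(n + k) choose k\<close>.\<close>
  define p where "p = smult (1 / fact k) (\<Prod>i=0..<k. [:real k - real i, 1:])"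
  have "real (card (multisets_of_size A n)) = poly p (real n)" for n
  proof -
    have "card (multisets_of_size A n) = (n + k) choose n"
      using card_multisets_of_size[OF assms, of n] Suc by (simp add: add.commute)
    also have "\<dots> = (n + k) choose k"
      using binomial_symmetric[of n "n + k"] by simp
    finally show ?thesis
      by (simp add: binomial_gbinomial gbinomial_prod_rev p_def poly_prod algebra_simps)
  qed
  then show ?thesis unfolding eventually_poly_def by (intro exI[of _ p]) simp
qed

text \<open>From the multisets avoiding \<open>vs\<close>, remove those that contain
  \<open>v\<close>; subtracting \<open>v\<close> turns the latter into multisets of size
  \<open>n - size v\<close> avoiding every \<open>u - v\<close>. Both counts have one constraint
  less. The induction is on the length of the list because the constraints themselves
  change.\<close>

lemma eventually_poly_card_avoiding:
  assumes "finite A" "\<forall>u\<in>set us. set_mset u \<subseteq> A"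
  shows "eventually_poly (\<lambda>n. real (card {M \<in> multisets_of_size A n. \<forall>u\<in>set us. \<not> u \<subseteq># M}))"
  using assms(2)
proof (induction "length us" arbitrary: us)
  case 0
  then show ?case using eventually_poly_card_multisets_of_size[OF assms(1)] by simp
next
  case (Suc l)
  then obtain v vs where us: "us = v # vs" by (cases us) auto
  let ?ws = "map (\<lambda>u. u - v) vs"
  let ?X = "\<lambda>us n. {M \<in> multisets_of_size A n. \<forall>u\<in>set us. \<not> u \<subseteq># M}"
  have sub: "set_mset (u - v) \<subseteq> set_mset u" for u
    by (meson diff_subset_eq_self set_mset_mono)
  have "eventually_poly (\<lambda>n. real (card (?X vs n)))"
    using Suc us by (intro Suc(1)) auto
  moreover have "eventually_poly (\<lambda>n. real (card (?X ?ws n)))"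
    using Suc us sub by (intro Suc(1)) fastforce+
  ultimately have poly: "eventually_poly
      (\<lambda>n. real (card (?X vs n)) - real (card (?X ?ws (n - size v))))"
    by (intro eventually_poly_diff eventually_poly_shift)
  \<comment> \<open>For n < \<open>size v\<close> the truncated size is 0 and the empty multiset may
    be counted, so the identity can fail.\<close>
  have "real (card (?X vs n)) - real (card (?X ?ws (n - size v))) = real (card (?X us n))"
    if n: "n \<ge> size v" for n
  proof -
    have fin [simp]: "finite (multisets_of_size A n)"
      using finite_multisets_of_size[OF assms(1)] .
    \<comment> \<open>The bijection is \<open>M\<close> to \<open>M - v\<close>; containing
      \<open>u\<close> after adding \<open>v\<close> means containing \<open>u - v\<close>
      before.\<close>
    have img: "{M \<in> ?X vs n. v \<subseteq># M} = (+) v ` ?X ?ws (n - size v)"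
    proof (intro equalityI subsetI)
      fix M assume M: "M \<in> {M \<in> ?X vs n. v \<subseteq># M}"
      then have "M = v + (M - v)" by simp
      moreover have "M - v \<in> ?X ?ws (n - size v)"
        using M sub[of M]
        by (auto simp: multisets_of_size_def size_Diff_submset subset_eq_diff_conv)
      ultimately show "M \<in> (+) v ` ?X ?ws (n - size v)" by blast
    next
      fix M assume "M \<in> (+) v ` ?X ?ws (n - size v)"
      then show "M \<in> {M \<in> ?X vs n. v \<subseteq># M}"
        using Suc(3) us n
        by (auto simp: multisets_of_size_def subset_eq_diff_conv add.commute)
    qed
    have "card (?X ?ws (n - size v)) = card {M \<in> ?X vs n. v \<subseteq># M}"
      unfolding img by (simp add: card_image)
    moreover have "?X us n = ?X vs n - {M \<in> ?X vs n. v \<subseteq># M}"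
      using us by auto
    moreover have "card {M \<in> ?X vs n. v \<subseteq># M} \<le> card (?X vs n)"
      using fin by (intro card_mono) auto
    ultimately show ?thesis
      using fin by (subst \<open>?X us n = _\<close>, subst card_Diff_subset) auto
  qed
  then have "\<forall>\<^sub>F n in sequentially.
      real (card (?X vs n)) - real (card (?X ?ws (n - size v))) = real (card (?X us n))"
    unfolding eventually_sequentially by blast
  with poly show ?case by (rule eventually_poly_cong)
qed

section \<open>Dickson's lemma for multisets over a finite set\<close>

lemma nat_seq_mono_subseq:
  fixes f :: "nat \<Rightarrow> nat"
  obtains r :: "nat \<Rightarrow> nat" where "strict_mono r" "mono (\<lambda>n. f (r n))"
proof -
  obtain r where r: "strict_mono r" "monoseq (\<lambda>n. f (r n))"
    using seq_monosub by blast
  from r(2) consider "incseq (\<lambda>n. f (r n))" | "decseq (\<lambda>n. f (r n))"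
    unfolding monoseq_iff by blast
  then show thesis
  proof cases
    case 1
    then show ?thesis using that r(1) by blast
  next
    \<comment> \<open>A decreasing sequence of naturals attains its minimum and is constant from
      there on, so this tail is also nondecreasing.\<close>
    case 2
    define k where "k = (LEAST k. \<exists>n. f (r n) = k)"
    have "\<exists>n. f (r n) = k" unfolding k_def by (rule LeastI[of _ "f (r 0)"]) blast
    then obtain N where N: "f (r N) = k" by blast
    have "k \<le> f (r n)" for n unfolding k_def by (rule Least_le) blast
    then have "f (r (n + N)) = k" for n
      using decseqD[OF 2, of N "n + N"] N by (simp add: le_antisym)
    moreover have "strict_mono (\<lambda>n. r (n + N))"
      using r(1) by (simp add: strict_mono_def)
    ultimately show ?thesis using that[of "\<lambda>n. r (n + N)"] by (simp add: mono_def)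
  qed
qed

text \<open>The subsequence is refined once for each element of \<open>A\<close>; refining preserves
  the monotonicity already achieved.\<close>

lemma multiset_seq_mono_subseq:
  fixes f :: "nat \<Rightarrow> 'a multiset"
  assumes "finite A"
  shows "\<exists>r :: nat \<Rightarrow> nat. strict_mono r \<and> (\<forall>a\<in>A. mono (\<lambda>n. count (f (r n)) a))"
  using assms
proof (induction A)
  case empty
  then show ?case by (auto intro: exI[of _ id] simp: strict_mono_def)
next
  case (insert a A)
  then obtain r :: "nat \<Rightarrow> nat" where r: "strict_mono r" "\<forall>b\<in>A. mono (\<lambda>n. count (f (r n)) b)" by blast
  obtain s :: "nat \<Rightarrow> nat" where s: "strict_mono s" "mono (\<lambda>n. count (f (r (s n))) a)"
    by (rule nat_seq_mono_subseq[of "\<lambda>n. count (f (r n)) a"])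
  have "strict_mono (\<lambda>n. r (s n))" using r(1) s(1) by (simp add: strict_mono_def)
  moreover have "mono (\<lambda>n. count (f (r (s n))) b)" if "b \<in> insert a A" for b
  proof (cases "b = a")
    case False
    then have "mono (\<lambda>n. count (f (r n)) b)" using that r by blast
    moreover have "mono s" using s(1) by (rule strict_mono_mono)
    ultimately show ?thesis by (simp add: mono_def)
  qed (use s in simp)
  ultimately show ?case by (intro exI[of _ "\<lambda>n. r (s n)"]) blast
qed

text \<open>The minimal elements of \<open>T\<close> suffice, by descent on size. They form an
  antichain, whereas a sequence of distinct ones would have a subsequence with nondecreasing
  multiplicities and hence two comparable members.\<close>

lemma dickson_multiset:
  assumes "finite A" "\<forall>M\<in>T. set_mset M \<subseteq> A"
  obtains U where "finite U" "U \<subseteq> T" "\<And>M. M \<in> T \<Longrightarrow> \<exists>u\<in>U. u \<subseteq># M"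
proof
  define U where "U = {u \<in> T. \<forall>v\<in>T. v \<subseteq># u \<longrightarrow> v = u}"
  show "U \<subseteq> T" unfolding U_def by blast
  show "\<exists>u\<in>U. u \<subseteq># M" if "M \<in> T" for M
    using that
  proof (induction M rule: measure_induct_rule[of size])
    case (less M)
    show ?case
    proof (cases "M \<in> U")
      case False
      then obtain v where v: "v \<in> T" "v \<subset># M"
        using less.prems unfolding U_def by (auto simp: subset_mset_def)
      then obtain u where "u \<in> U" "u \<subseteq># v"
        using less.IH[of v] mset_subset_size by blast
      then show ?thesis using v(2) by (meson subset_mset.less_imp_le subset_mset.order_trans)
    qed auto
  qed
  show "finite U"
  proof (rule ccontr)
    assume "infinite U"
    then obtain f :: "nat \<Rightarrow> 'a multiset" where f: "inj f" "range f \<subseteq> U"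
      using infinite_countable_subset by blast
    obtain r :: "nat \<Rightarrow> nat" where r: "strict_mono r" "\<forall>a\<in>A. mono (\<lambda>n. count (f (r n)) a)"
      using multiset_seq_mono_subseq[OF assms(1), of f] by blast
    have fT: "f n \<in> T" for n using f(2) unfolding U_def by blast
    have "f (r 0) \<subseteq># f (r 1)"
    proof (rule mset_subset_eqI)
      fix a
      show "count (f (r 0)) a \<le> count (f (r 1)) a"
      proof (cases "a \<in> A")
        case True
        then show ?thesis using r(2) by (simp add: mono_def)
      next
        case False
        then have "a \<notin># f (r 0)" using fT assms(2) by blast
        then show ?thesis by (simp add: not_in_iff)
      qed
    qed
    moreover have "f (r 1) \<in> U" using f(2) by blast
    ultimately have "f (r 0) = f (r 1)" using fT unfolding U_def by blast
    then have "r 0 = r 1" using f(1) by (simp add: inj_def)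
    then show False using r(1) by (metis strict_mono_eq zero_neq_one)
  qed
qed

section \<open>Unique representatives of least weight\<close>

text \<open>
  A total order on multisets over \<open>A\<close> that is compatible with addition: compare the products
  of pairwise distinct primes attached to the elements of \<open>A\<close>.
\<close>

lemma additive_multiset_weight:
  assumes "finite A"
  obtains W :: "'a multiset \<Rightarrow> nat" where "\<And>M N. W (M + N) = W M * W N"
    "\<And>M. set_mset M \<subseteq> A \<Longrightarrow> W M > 0"
    "inj_on W {M. set_mset M \<subseteq> A}"
proof -
  obtain P :: "nat set" where P: "finite P" "card P = card A" "P \<subseteq> {p. prime p}"
    using infinite_arbitrarily_large[OF primes_infinite] by blast
  then obtain p where p: "bij_betw p A P"
    using finite_same_card_bij[OF assms] by metis
  have prime: "prime (p a)" if "a \<in> A" for a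
    using p P(3) that bij_betwE by blast
  define W where "W M = prod_mset (image_mset p M)" for M
  \<comment> \<open>By unique factorization \<open>W M\<close> determines
    \<open>image_mset p M\<close>, and thereby \<open>M\<close>, since \<open>p\<close> is injective
    on \<open>A\<close>.\<close>
  have fact: "prime_factorization (W M) = image_mset p M" if "set_mset M \<subseteq> A" for M
    unfolding W_def using that prime by (intro prime_factorization_prod_mset_primes) auto
  show thesis
  proof
    show "W (M + N) = W M * W N" for M N by (simp add: W_def)
    show "W M > 0" if "set_mset M \<subseteq> A" for M
      using that prime unfolding W_def
      by (metis (no_types, lifting) bot_nat_0.not_eq_extremum imageE not_prime_0 prod_mset_zero_iff set_image_mset subsetD)
    show "inj_on W {M. set_mset M \<subseteq> A}"
    proof (rule inj_onI, clarify)
      fix M N assume MN: "set_mset M \<subseteq> A" "set_mset N \<subseteq> A" "W M = W N"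
      then have "image_mset p M = image_mset p N" by (metis fact)
      moreover have "inj_on p A" using p by (simp add: bij_betw_def)
      ultimately show "M = N" using MN(1,2)
        by (intro multiset.inj_map_strong[of M N p p]) (auto dest: inj_onD)
    qed
  qed
qed

text \<open>
  Each element of the \<open>n\<close>-fold sumset is represented by a unique multiset
  of least weight, and the multisets that are not of least weight form an upward closed set.
\<close>

theorem khovanskii:
  fixes A :: "'a::comm_monoid_add set"
  assumes "finite A"
  shows "eventually_poly (\<lambda>n. real (card (sum_mset ` multisets_of_size A n)))"
proof -
  obtain W :: "'a multiset \<Rightarrow> nat" where W: "\<And>M N. W (M + N) = W M * W N"
    "\<And>M. set_mset M \<subseteq> A \<Longrightarrow> W M > 0" "inj_on W {M. set_mset M \<subseteq> A}"
    by (rule additive_multiset_weight[OF assms]) blast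
  define T where "T = {M. set_mset M \<subseteq> A \<and>
    (\<exists>N. set_mset N \<subseteq> A \<and> size N = size M \<and> sum_mset N = sum_mset M \<and> W N < W M)}"
  obtain U where U: "finite U" "U \<subseteq> T" "\<And>M. M \<in> T \<Longrightarrow> \<exists>u\<in>U. u \<subseteq># M"
    by (rule dickson_multiset[OF assms, of T]) (auto simp: T_def)
  obtain us where us: "set us = U" using finite_list[OF U(1)] by blast
  \<comment> \<open>Adding \<open>K\<close> multiplies both weights by the positive number
    \<open>W K\<close>, so a lighter rival of \<open>u\<close> yields one of
    \<open>M\<close>.\<close>
  have up: "M \<in> T" if "u \<in> T" "u \<subseteq># M" and M: "set_mset M \<subseteq> A" for u M
  proof -
    obtain N where N: "set_mset N \<subseteq> A" "size N = size u" "sum_mset N = sum_mset u" "W N < W u"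
      using \<open>u \<in> T\<close> unfolding T_def by blast
    obtain K where K: "M = u + K" using \<open>u \<subseteq># M\<close> by (metis subset_mset.le_iff_add)
    have "W K > 0" using W(2) M K by simp
    then have "set_mset (N + K) \<subseteq> A \<and> size (N + K) = size M
        \<and> sum_mset (N + K) = sum_mset M \<and> W (N + K) < W M"
      using N K M W(1) by simp
    then show ?thesis unfolding T_def using M by blast
  qed
  have "card (sum_mset ` multisets_of_size A n)
      = card {M \<in> multisets_of_size A n. \<forall>u\<in>set us. \<not> u \<subseteq># M}" for n
  proof -
    let ?R = "{M \<in> multisets_of_size A n. \<forall>u\<in>set us. \<not> u \<subseteq># M}"
    \<comment> \<open>Over \<open>A\<close> the set \<open>T\<close> is upward closed and each of
      its members contains one of \<open>U\<close>; so avoiding \<open>U\<close> means lying outside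
      \<open>T\<close>.\<close>
    have R: "?R = {M \<in> multisets_of_size A n. M \<notin> T}"
      unfolding us multisets_of_size_def using U(2,3) up by blast
    have "inj_on sum_mset ?R"
    proof (rule inj_onI)
      fix M N assume MN: "M \<in> ?R" "N \<in> ?R" "sum_mset M = sum_mset N"
      then have "set_mset M \<subseteq> A" "set_mset N \<subseteq> A" "size M = size N" "M \<notin> T" "N \<notin> T"
        using R by (auto simp: multisets_of_size_def)
      then have "\<not> W M < W N" "\<not> W N < W M"
        using MN(3) unfolding T_def mem_Collect_eq by metis+
      then have "W M = W N" by simp
      then show "M = N" using W(3) MN(1,2) by (auto simp: multisets_of_size_def dest: inj_onD)
    qed
    moreover have "sum_mset ` ?R = sum_mset ` multisets_of_size A n"
    proof (intro equalityI subsetI)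
      fix x assume "x \<in> sum_mset ` multisets_of_size A n"
      then obtain M0 where "M0 \<in> multisets_of_size A n \<and> sum_mset M0 = x" by blast
      from ex_has_least_nat[of "\<lambda>M. M \<in> multisets_of_size A n \<and> sum_mset M = x", OF this, of W]
      obtain M where M: "M \<in> multisets_of_size A n" "sum_mset M = x"
        "\<And>N. N \<in> multisets_of_size A n \<Longrightarrow> sum_mset N = x \<Longrightarrow> W M \<le> W N" by blast
      have "M \<notin> T"
      proof
        assume "M \<in> T"
        then obtain N where "N \<in> multisets_of_size A n" "sum_mset N = x" "W N < W M"
          using M(1,2) unfolding T_def multisets_of_size_def mem_Collect_eq by metis
        then show False using M(3)[of N] by simp
      qed
      then show "x \<in> sum_mset ` ?R" unfolding R using M by blast
    qed auto
    ultimately show ?thesis using card_image by fastforce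
  qed
  moreover have "\<forall>u\<in>set us. set_mset u \<subseteq> A" using us U(2) unfolding T_def by blast
  ultimately show ?thesis using eventually_poly_card_avoiding[OF assms] by simp
qed

section \<open>Asymptotics of polynomials\<close>

text \<open>This is the step of the inductions below. Exponents are integers because
  \<open>int d - 2\<close> is negative for d = 1 and those inductions start at -1 and -2.\<close>

lemma bigo_times_powi:
  assumes "f \<in> O(\<lambda>n. real n powi k)"
  shows "(\<lambda>n. real n * f n) \<in> O(\<lambda>n. real n powi (k + 1))"
proof -
  have "(\<lambda>n. real n * f n) \<in> O(\<lambda>n. real n * real n powi k)"
    using assms by (intro landau_o.big.mult) auto
  also have "(\<lambda>n. real n * real n powi k) \<in> O(\<lambda>n. real n powi (k + 1))"
    by (intro landau_o.bigI[of 1] eventually_sequentiallyI[of 1])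
      (auto simp: power_int_add abs_mult mult.commute)
  finally show ?thesis .
qed

lemma powi_bigo_mono:
  assumes "k \<le> l"
  shows "(\<lambda>n. real n powi k) \<in> O(\<lambda>n. real n powi l)"
  using assms
  by (intro landau_o.bigI[of 1] eventually_sequentiallyI[of 1])
    (auto simp: power_int_increasing)

text \<open>(n + a)^(i+1) - n^(i+1) = (n + a) ((n + a)^i - n^i) + a n^i, and each resulting term is
  O(n^i).\<close>

lemma power_shift_bigo:
  "(\<lambda>n. (real n + a) ^ i - real n ^ i) \<in> O(\<lambda>n. real n powi (int i - 1))"
proof (induction i)
  case (Suc i)
  let ?f = "\<lambda>n. (real n + a) ^ i - real n ^ i"
  have n: "(\<lambda>n. real n * ?f n) \<in> O(\<lambda>n. real n powi int i)"
    using bigo_times_powi[OF Suc] by simp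
  have a: "(\<lambda>n. a * ?f n) \<in> O(\<lambda>n. real n powi int i)"
    using landau_o.big_trans[OF Suc powi_bigo_mono[of "int i - 1" "int i"]]
    by (cases "a = 0") simp_all
  have "(\<lambda>n. a * real n ^ i) \<in> O(\<lambda>n. real n powi int i)"
    by (cases "a = 0") simp_all
  with sum_in_bigo(1)[OF n a]
  have "(\<lambda>n. real n * ?f n + a * ?f n + a * real n ^ i) \<in> O(\<lambda>n. real n powi int i)"
    by (rule sum_in_bigo(1))
  then show ?case by (simp add: algebra_simps)
qed simp

text \<open>The same recursion one order further: the new error is n times the old one plus
  \<open>a\<close> times a difference controlled by \<open>power_shift_bigo\<close>.\<close>

lemma power_shift_second_order_bigo:
  "(\<lambda>n. (real n + a) ^ i - real n ^ i - real i * a * real n powi (int i - 1))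
     \<in> O(\<lambda>n. real n powi (int i - 2))"
proof (induction i)
  case (Suc i)
  let ?f = "\<lambda>n. (real n + a) ^ i - real n ^ i - real i * a * real n powi (int i - 1)"
  have n: "(\<lambda>n. real n * ?f n) \<in> O(\<lambda>n. real n powi (int i - 1))"
    using bigo_times_powi[OF Suc] by simp
  have "(\<lambda>n. a * ((real n + a) ^ i - real n ^ i)) \<in> O(\<lambda>n. real n powi (int i - 1))"
    using power_shift_bigo[of a i] by (cases "a = 0") simp_all
  from sum_in_bigo(1)[OF n this]
  have "(\<lambda>n. real n * ?f n + a * ((real n + a) ^ i - real n ^ i))
      \<in> O(\<lambda>n. real n powi (int i - 1))" .
  moreover have "real n * ?f n + a * ((real n + a) ^ i - real n ^ i)
      = (real n + a) ^ Suc i - real n ^ Suc i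
        - real (Suc i) * a * real n powi (int (Suc i) - 1)" for n
  proof -
    \<comment> \<open>For i = 0 the factor \<open>real i\<close> absorbs the exponent -1; otherwise
      the exponent is a natural number.\<close>
    have "real i * real n * real n powi (int i - 1) = real i * real n ^ i"
      by (cases i) (simp_all add: power_int_def nat_add_distrib)
    moreover have "x * (p - q - k * a * r) + a * (p - q) = (x + a) * p - x * q - (1 + k) * a * q"
      if "k * x * r = k * q" for x p q k r :: real
      using that by algebra
    ultimately show ?thesis by simp
  qed
  ultimately show ?case by simp
qed simp

section \<open>Polynomials with known leading term and their differences\<close>

lemma degree_less_if_bigo:
  assumes "(\<lambda>n. poly q (real n)) \<in> O(\<lambda>n. real n powi (int d - 1))" "d > 0"
  shows "degree q < d"
proof (rule ccontr)
  assume d: "\<not> degree q < d"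
  let ?m = "degree q"
  \<comment> \<open>The quotient tends to the leading coefficient, but the assumed bound forces the
    limit 0. Then \<open>q\<close> is zero and has degree 0 < d.\<close>
  have "((\<lambda>n. poly q (real n) / real n ^ ?m) \<longlongrightarrow> lead_coeff q) sequentially"
    using filterlim_compose[OF poly_divide_tendsto_aux[of q]
        filterlim_compose[OF filterlim_at_top_imp_at_infinity[OF filterlim_ident] filterlim_real_sequentially]]
    by simp
  moreover have "((\<lambda>n. poly q (real n) / real n ^ ?m) \<longlongrightarrow> 0) sequentially"
  proof -
    have "(\<lambda>n. poly q (real n) / real n ^ ?m) \<in> O(\<lambda>n. real n powi (int d - 1) / real n ^ ?m)"
      using assms(1) by (intro landau_o.big.divide) (auto intro!: eventually_sequentiallyI[of 1])
    also have "(\<lambda>n. real n powi (int d - 1) / real n ^ ?m) \<in> O(\<lambda>n. 1 / real n)"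
    proof (intro landau_o.bigI[of 1] eventually_sequentiallyI[of 1])
      fix n :: nat assume n: "n \<ge> 1"
      have "real n powi (int d - 1) / real n ^ ?m = real n powi (int d - 1 - int ?m)"
        using n by (simp add: power_int_diff)
      also have "\<dots> \<le> real n powi (- 1)"
        using n d by (intro power_int_increasing) auto
      finally show "norm (real n powi (int d - 1) / real n ^ ?m) \<le> 1 * norm (1 / real n)"
        using n by (simp add: power_int_minus field_simps)
    qed simp
    finally have "(\<lambda>n. poly q (real n) / real n ^ ?m) \<in> O(\<lambda>n. 1 / real n)" .
    moreover have "(\<lambda>n. 1 / real n) \<in> o(\<lambda>_. 1)"
      using lim_1_over_n[where 'a = real] by (intro smalloI_tendsto) simp_all
    ultimately have "(\<lambda>n. poly q (real n) / real n ^ ?m) \<in> o(\<lambda>_. 1)"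
      by (rule landau_o.big_small_trans)
    then show ?thesis using smalloD_tendsto by fastforce
  qed
  ultimately have "lead_coeff q = 0" by (rule LIMSEQ_unique)
  then show False using d assms(2) by simp
qed

text \<open>After removal of V n^d, what is left of \<open>f\<close> is eventually a polynomial of
  degree below d, so differencing lowers its order to d - 2. The difference of V n^d is expanded to
  second order.\<close>

lemma eventually_poly_difference_bigo:
  assumes "eventually_poly f" "d > 0"
    and f: "(\<lambda>n. f n - V * real n ^ d) \<in> O(\<lambda>n. real n powi (int d - 1))"
  shows "(\<lambda>n. f n - f (n - 1) - real d * V * real n powi (int d - 1))
           \<in> O(\<lambda>n. real n powi (int d - 2))"
proof -
  obtain p N where p: "\<And>n. n \<ge> N \<Longrightarrow> f n = poly p (real n)"
    using assms(1) unfolding eventually_poly_def eventually_sequentially by blast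
  define q where "q = p - monom V d"
  have fq: "f n = poly q (real n) + V * real n ^ d" if "n \<ge> N" for n
    using p[OF that] by (simp add: q_def poly_monom)
  have "(\<lambda>n. poly q (real n)) \<in> O(\<lambda>n. real n powi (int d - 1))"
    using f by (rule landau_o.big.in_cong[THEN iffD1, rotated])
      (auto intro!: eventually_sequentiallyI[of N] simp: fq)
  then have deg: "degree q < d" using \<open>d > 0\<close> by (rule degree_less_if_bigo)
  \<comment> \<open>The shift by -1 gives the negative of a backward difference; the outer minus
    sign below undoes this.\<close>
  let ?D = "\<lambda>i n. (real n + (- 1)) ^ i - real n ^ i"
  let ?E = "\<lambda>n. V * (?D d n - real d * (- 1) * real n powi (int d - 1))"
  have "(\<lambda>n. coeff q i * ?D i n) \<in> O(\<lambda>n. real n powi (int d - 2))" if "i \<le> degree q" for i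
    using landau_o.big_trans[OF power_shift_bigo[of "- 1" i] powi_bigo_mono[of _ "int d - 2"]]
      that deg by (cases "coeff q i = 0") simp_all
  then have 1: "(\<lambda>n. \<Sum>i\<le>degree q. coeff q i * ?D i n) \<in> O(\<lambda>n. real n powi (int d - 2))"
    by (intro big_sum_in_bigo) simp
  have 2: "?E \<in> O(\<lambda>n. real n powi (int d - 2))"
    using power_shift_second_order_bigo[of "- 1" d] by (cases "V = 0") simp_all
  have "(\<lambda>n. - ((\<Sum>i\<le>degree q. coeff q i * ?D i n) + ?E n)) \<in> O(\<lambda>n. real n powi (int d - 2))"
    unfolding landau_o.big.uminus_in_iff by (rule sum_in_bigo(1)[OF 1 2])
  \<comment> \<open>From \<open>N + 1\<close> on, n - 1 also lies in the range where
    \<open>f\<close> agrees with \<open>p\<close>.\<close>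
  moreover have "- ((\<Sum>i\<le>degree q. coeff q i * ?D i n) + ?E n)
      = f n - f (n - 1) - real d * V * real n powi (int d - 1)" if "n \<ge> N + 1" for n
  proof -
    have "f (n - 1) = poly q (real n + (- 1)) + V * (real n + (- 1)) ^ d"
      using fq[of "n - 1"] that by (simp add: of_nat_diff)
    moreover have "(\<Sum>i\<le>degree q. coeff q i * ?D i n) = poly q (real n + (- 1)) - poly q (real n)"
      by (simp only: poly_altdef right_diff_distrib sum_subtractf)
    ultimately show ?thesis using fq[of n] that by (simp add: algebra_simps)
  qed
  ultimately show ?thesis
    by (elim landau_o.big.in_cong[THEN iffD1, rotated])
      (auto intro!: eventually_sequentiallyI[of "N + 1"])
qed

text \<open>The error lies between the shifts by -a and b, so the sum of their absolute values
  dominates it.\<close>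

lemma bigo_squeeze_shifted_powers:
  fixes f :: "nat \<Rightarrow> real"
  assumes "\<And>n. n \<ge> a \<Longrightarrow> V * real (n - a) ^ d \<le> f n" "\<And>n. f n \<le> V * real (n + b) ^ d"
  shows "(\<lambda>n. f n - V * real n ^ d) \<in> O(\<lambda>n. real n powi (int d - 1))"
proof -
  let ?D = "\<lambda>c n. V * ((real n + c) ^ d - real n ^ d)"
  have D: "?D c \<in> O(\<lambda>n. real n powi (int d - 1))" for c
    using power_shift_bigo[of c d] by (cases "V = 0") simp_all
  have "(\<lambda>n. f n - V * real n ^ d) \<in> O(\<lambda>n. \<bar>?D (- real a) n\<bar> + \<bar>?D (real b) n\<bar>)"
  proof (intro landau_o.bigI[of 1] eventually_sequentiallyI[of a])
    fix n assume "n \<ge> a"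
    then have "?D (- real a) n \<le> f n - V * real n ^ d" "f n - V * real n ^ d \<le> ?D (real b) n"
      using assms(1)[of n] assms(2)[of n] by (simp_all add: of_nat_diff algebra_simps)
    then show "norm (f n - V * real n ^ d) \<le> 1 * norm (\<bar>?D (- real a) n\<bar> + \<bar>?D (real b) n\<bar>)"
      by auto
  qed simp
  also have "(\<lambda>n. \<bar>?D (- real a) n\<bar> + \<bar>?D (real b) n\<bar>) \<in> O(\<lambda>n. real n powi (int d - 1))"
    using D by (intro sum_in_bigo(1)) (simp_all only: landau_o.big.abs_in_iff)
  finally show ?thesis .
qed

section \<open>Word balls and the convex hull of the generators\<close>

text \<open>\<open>group_closure\<close> is built up by differences; symmetry turns negated letters
  into letters.\<close>

lemma generating_word_exists:
  assumes "symmetric S" "generating S"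
  shows "\<exists>xs. set xs \<subseteq> S \<and> sum_list xs = w"
proof -
  have "w \<in> group_closure S" using assms(2) by (simp add: generating_def)
  then show ?thesis
  proof induction
    case (base s)
    then show ?case
    proof
      assume "s = 0"
      then show ?thesis by (intro exI[of _ "[]"]) simp
    next
      assume "s \<in> S"
      then show ?thesis by (intro exI[of _ "[s]"]) simp
    qed
  next
    case (diff s t)
    then obtain xs ys where "set xs \<subseteq> S" "sum_list xs = s" "set ys \<subseteq> S" "sum_list ys = t"
      by blast
    moreover have "uminus ` S = S" using assms(1) by (simp add: symmetric_def)
    ultimately have "set (xs @ map uminus ys) \<subseteq> S" "sum_list (xs @ map uminus ys) = s - t"
      by (auto simp: uminus_sum_list_map[of id, simplified, symmetric])
    then show ?case by blast
  qed
qed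

context
  fixes S :: "(int ^ 'd::finite) set"
  assumes finite: "finite S" and symmetric: "symmetric S" and generating: "generating S"
begin

text \<open>Every element has a word, so the \<open>LEAST\<close> in \<open>word_length\<close> is
  attained.\<close>

lemma word_ball_iff:
  "w \<in> word_ball S n \<longleftrightarrow> (\<exists>xs. length xs \<le> n \<and> set xs \<subseteq> S \<and> sum_list xs = w)"
proof
  let ?P = "\<lambda>n. \<exists>xs. length xs = n \<and> set xs \<subseteq> S \<and> sum_list xs = w"
  assume "w \<in> word_ball S n"
  moreover have "\<exists>n. ?P n" using generating_word_exists[OF symmetric generating] by blast
  then have "?P (word_length S w)" unfolding word_length_def by (rule LeastI_ex)
  ultimately show "\<exists>xs. length xs \<le> n \<and> set xs \<subseteq> S \<and> sum_list xs = w"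
    unfolding word_ball_def mem_Collect_eq by metis
next
  assume "\<exists>xs. length xs \<le> n \<and> set xs \<subseteq> S \<and> sum_list xs = w"
  then obtain xs where xs: "length xs \<le> n" "set xs \<subseteq> S" "sum_list xs = w" by blast
  then have "word_length S w \<le> length xs"
    unfolding word_length_def by (intro Least_le) blast
  then show "w \<in> word_ball S n" using xs(1) by (simp add: word_ball_def)
qed

text \<open>Padding with zeros brings a word to length exactly n, and deleting zeros reverses this.
  By commutativity words may be read as multisets, as \<open>khovanskii\<close> requires.\<close>

lemma word_ball_eq_sumset:
  "word_ball S n = sum_mset ` multisets_of_size (insert 0 S) n"
proof (intro equalityI subsetI)
  fix w assume "w \<in> word_ball S n"
  then obtain xs where xs: "length xs \<le> n" "set xs \<subseteq> S" "sum_list xs = w"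
    by (auto simp: word_ball_iff)
  let ?M = "mset (xs @ replicate (n - length xs) 0)"
  have "sum_mset ?M = w" using xs by (simp only: sum_mset_sum_list) (simp add: sum_list_replicate)
  moreover have "?M \<in> multisets_of_size (insert 0 S) n"
    using xs by (auto simp: multisets_of_size_def)
  ultimately show "w \<in> sum_mset ` multisets_of_size (insert 0 S) n" by blast
next
  fix w assume "w \<in> sum_mset ` multisets_of_size (insert 0 S) n"
  then obtain M where M: "w = sum_mset M" "set_mset M \<subseteq> insert 0 S" "size M = n"
    by (auto simp: multisets_of_size_def)
  obtain xs where xs: "mset xs = M" using ex_mset by blast
  have "length (filter (\<lambda>x. x \<noteq> 0) xs) \<le> n"
    using M(3) xs by (metis length_filter_le size_mset)
  moreover have "set (filter (\<lambda>x. x \<noteq> 0) xs) \<subseteq> S" using M(2) xs by auto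
  moreover have "sum_list (filter (\<lambda>x. x \<noteq> 0) xs) = w"
  proof -
    have "sum_list (filter (\<lambda>x. x \<noteq> 0) xs) = sum_list xs" by (induction xs) auto
    then show ?thesis using M(1) xs by (simp add: sum_mset_sum_list[symmetric])
  qed
  ultimately show "w \<in> word_ball S n" unfolding word_ball_iff by blast
qed

lemma finite_word_ball: "finite (word_ball S n)"
  unfolding word_ball_eq_sumset using finite by auto

lemma eventually_poly_growth: "eventually_poly (\<lambda>n. real (growth S n))"
  unfolding growth_def word_ball_eq_sumset using finite by (intro khovanskii) simp

text \<open>At n = 0 truncation would make the right side 0, while the sphere is {0}.\<close>

lemma spherical_growth_eq:
  assumes "n > 0"
  shows "real (spherical_growth S n) = real (growth S n) - real (growth S (n - 1))"
proof -
  have "word_sphere S n = word_ball S n - word_ball S (n - 1)"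
    using assms by (auto simp: word_sphere_def word_ball_def)
  moreover have sub: "word_ball S (n - 1) \<subseteq> word_ball S n"
    by (auto simp: word_ball_def)
  ultimately show ?thesis
    using card_mono[OF finite_word_ball sub]
    by (simp add: spherical_growth_def growth_def card_Diff_subset finite_word_ball of_nat_diff)
qed

lemma word_ball_0: "0 \<in> word_ball S n"
  unfolding word_ball_iff by (intro exI[of _ "[]"]) simp

lemma word_ball_add:
  assumes "v \<in> word_ball S m" "w \<in> word_ball S n"
  shows "v + w \<in> word_ball S (m + n)"
proof -
  obtain xs ys where "length xs \<le> m" "set xs \<subseteq> S" "sum_list xs = v"
    "length ys \<le> n" "set ys \<subseteq> S" "sum_list ys = w"
    using assms by (auto simp: word_ball_iff)
  then show ?thesis unfolding word_ball_iff by (intro exI[of _ "xs @ ys"]) simp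
qed

lemma word_ball_mono: "m \<le> n \<Longrightarrow> word_ball S m \<subseteq> word_ball S n"
  by (auto simp: word_ball_def)

text \<open>\<open>of_nat (k a)\<close> is a constant vector and the product is componentwise, so
  each summand is the value of the word repeating \<open>a\<close> exactly \<open>k a\<close>
  times.\<close>

lemma word_ball_sum_multiples:
  assumes "T \<subseteq> S"
  shows "(\<Sum>a\<in>T. of_nat (k a) * a) \<in> word_ball S (\<Sum>a\<in>T. k a)"
proof -
  have "finite T" using assms finite finite_subset by blast
  then show ?thesis using assms
  proof (induction T)
    case (insert a T)
    have "of_nat (k a) * a \<in> word_ball S (k a)"
      unfolding word_ball_iff using insert.prems
      by (intro exI[of _ "replicate (k a) a"]) (auto simp: sum_list_replicate)
    then show ?case using insert by (simp add: word_ball_add)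
  qed (simp add: word_ball_0)
qed

lemma finite_subset_word_ball:
  assumes "finite R"
  obtains n where "R \<subseteq> word_ball S n"
proof
  show "R \<subseteq> word_ball S (\<Sum>w\<in>R. word_length S w)"
    using assms by (auto simp: word_ball_def intro: member_le_sum)
qed

end

section \<open>The embedding of the lattice, and dilates of convex sets\<close>

lemma real_vec_simps [simp]:
  "real_vec 0 = 0" "real_vec (v + w) = real_vec v + real_vec w"
  "real_vec (- v) = - real_vec v" "real_vec (v - w) = real_vec v - real_vec w"
  "real_vec (of_nat k * w) = real k *\<^sub>R real_vec w"
  by (simp_all add: real_vec_def vec_eq_iff of_nat_index)

lemma real_vec_sum: "real_vec (sum f T) = (\<Sum>a\<in>T. real_vec (f a))"
  by (induction T rule: infinite_finite_induct) simp_all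

lemma inj_real_vec: "inj real_vec"
  by (auto simp: inj_def real_vec_def vec_eq_iff)

text \<open>The sum is s + t times a convex combination with weights s/(s+t) and t/(s+t).\<close>

lemma scaleR_convex_add:
  assumes "convex Q" "s \<ge> 0" "t \<ge> 0" "x \<in> (*\<^sub>R) s ` Q" "y \<in> (*\<^sub>R) t ` Q"
  shows "x + y \<in> (*\<^sub>R) (s + t) ` Q"
proof (cases "s + t = 0")
  case True
  then have "s = 0" "t = 0" using assms(2,3) by auto
  then show ?thesis using assms(4,5) by auto
next
  case False
  obtain p q where pq: "p \<in> Q" "x = s *\<^sub>R p" "q \<in> Q" "y = t *\<^sub>R q" using assms(4,5) by blast
  have "(s / (s + t)) *\<^sub>R p + (t / (s + t)) *\<^sub>R q \<in> Q"
    using assms pq False by (intro convexD) (auto simp flip: add_divide_distrib)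
  moreover have "x + y = (s + t) *\<^sub>R ((s / (s + t)) *\<^sub>R p + (t / (s + t)) *\<^sub>R q)"
    using pq False by (simp add: scaleR_add_right)
  ultimately show ?thesis by blast
qed

lemma scaleR_convex_mono:
  assumes "convex Q" "0 \<in> Q" "0 \<le> s" "s \<le> t"
  shows "(*\<^sub>R) s ` Q \<subseteq> (*\<^sub>R) t ` Q"
proof
  fix x assume "x \<in> (*\<^sub>R) s ` Q"
  moreover have "0 \<in> (*\<^sub>R) (t - s) ` Q" using assms(2) by (intro image_eqI[of _ _ 0]) auto
  ultimately show "x \<in> (*\<^sub>R) t ` Q" using scaleR_convex_add[of Q s "t - s" x 0] assms by simp
qed

lemma scaleR_convex_sum:
  assumes "convex Q" "0 \<in> Q" "c \<ge> 0" "finite T" "\<And>i. i \<in> T \<Longrightarrow> f i \<in> (*\<^sub>R) c ` Q"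
  shows "sum f T \<in> (*\<^sub>R) (real (card T) * c) ` Q"
  using assms(4,5)
proof (induction T)
  case empty
  then show ?case using assms(2) by (auto intro: image_eqI[of _ _ 0])
next
  case (insert i T)
  then have "f i + sum f T \<in> (*\<^sub>R) (c + real (card T) * c) ` Q"
    using assms(1,3) by (intro scaleR_convex_add) auto
  then show ?case using insert by (simp add: algebra_simps)
qed

lemma finite_bounded_int_vecs: "finite {r :: int ^ 'd::finite. \<forall>i. \<bar>r $ i\<bar> \<le> B}"
proof (rule finite_subset)
  show "{r :: int ^ 'd. \<forall>i. \<bar>r $ i\<bar> \<le> B} \<subseteq> vec_lambda ` (PiE UNIV (\<lambda>_. {-B..B}))"
  proof
    fix r :: "int ^ 'd" assume r: "r \<in> {r. \<forall>i. \<bar>r $ i\<bar> \<le> B}"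
    have "r = vec_lambda (($) r)" by simp
    moreover have "($) r \<in> PiE UNIV (\<lambda>_. {-B..B})" using r by (auto simp: abs_le_iff minus_le_iff)
    ultimately show "r \<in> vec_lambda ` (PiE UNIV (\<lambda>_. {-B..B}))" by blast
  qed
qed (intro finite_imageI finite_PiE; simp)

text \<open>Here \<open>1\<close> is the all-ones vector. Open lattice cubes are disjoint and serve
  the upper bound; closed ones cover space and serve the lower bound.\<close>

lemma measure_unit_cube:
  fixes a :: "real ^ 'd::finite"
  shows "measure lebesgue (cbox a (a + 1)) = 1" "measure lebesgue (box a (a + 1)) = 1"
proof -
  show c: "measure lebesgue (cbox a (a + 1)) = 1"
    by (simp add: content_cbox_if_cart interval_eq_empty_cart)
  show "measure lebesgue (box a (a + 1)) = 1"
    using c by (simp add: measure_lborel_box_eq measure_lborel_cbox_eq)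
qed

section \<open>Word balls compared with dilates of the hull\<close>

context
  fixes S :: "(int ^ 'd::finite) set" and Q :: "(real ^ 'd) set"
  assumes finite: "finite S" and symmetric: "symmetric S" and generating: "generating S"
  defines "Q \<equiv> convex hull (real_vec ` S)"
begin

lemma convex_Q: "convex Q"
  by (simp add: Q_def)

lemma compact_Q: "compact Q"
  unfolding Q_def using finite by (intro compact_convex_hull finite_imp_compact) simp

text \<open>The origin is the midpoint of a generator and its negative; a generator exists because
  the lattice is nontrivial.\<close>

lemma zero_in_Q: "0 \<in> Q"
proof -
  have "S \<noteq> {}"
  proof
    assume "S = {}"
    then have "(UNIV :: (int ^ 'd) set) = {0}"
      using generating by (simp add: generating_def)
    moreover have "axis undefined 1 \<noteq> (0 :: int ^ 'd)" by (simp add: axis_eq_0_iff)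
    ultimately show False by blast
  qed
  then obtain a where a: "a \<in> S" by blast
  then have "- a \<in> S" using symmetric unfolding symmetric_def by blast
  then have "real_vec a \<in> Q" "- real_vec a \<in> Q"
    using a by (force simp: Q_def intro: hull_inc)+
  then have "(1 / 2) *\<^sub>R real_vec a + (1 / 2) *\<^sub>R (- real_vec a) \<in> Q"
    by (intro convexD[OF convex_Q]) auto
  then show ?thesis by simp
qed

text \<open>Each letter contributes one copy of \<open>Q\<close>; since 0 lies in \<open>Q\<close>,
  shorter words also land in the n-fold dilate.\<close>

lemma word_ball_subset:
  assumes "w \<in> word_ball S n"
  shows "real_vec w \<in> (*\<^sub>R) (real n) ` Q"
proof -
  obtain xs where xs: "length xs \<le> n" "set xs \<subseteq> S" "sum_list xs = w"
    using assms by (auto simp: word_ball_iff[OF finite symmetric generating])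
  have "real_vec (sum_list xs) \<in> (*\<^sub>R) (real (length xs)) ` Q"
    using xs(2)
  proof (induction xs)
    case Nil
    then show ?case using zero_in_Q by (auto intro: image_eqI[of _ _ 0])
  next
    case (Cons x xs)
    have "real_vec x \<in> (*\<^sub>R) 1 ` Q" using Cons.prems by (auto simp: Q_def intro: hull_inc)
    then have "real_vec x + real_vec (sum_list xs) \<in> (*\<^sub>R) (1 + real (length xs)) ` Q"
      using Cons by (intro scaleR_convex_add convex_Q) auto
    then show ?case by simp
  qed
  then show ?thesis
    using xs scaleR_convex_mono[OF convex_Q zero_in_Q, of "real (length xs)" "real n"] by auto
qed

text \<open>
  Rounding down the coefficients of a convex representation of \<open>w\<close> leaves a lattice vector
  from a fixed finite set.
\<close>

lemma lattice_points_subset: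
  obtains C where "\<And>n w. real_vec w \<in> (*\<^sub>R) (real n) ` Q \<Longrightarrow> w \<in> word_ball S (n + C)"
proof -
  \<comment> \<open>\<open>B\<close> bounds every coordinate of a combination of \<open>S\<close>
    with coefficients in [0,1], which is what rounding leaves over.\<close>
  define B where "B = (\<Sum>a\<in>S. \<Sum>i\<in>UNIV. \<bar>a $ i\<bar>)"
  obtain C where C: "{r :: int ^ 'd. \<forall>i. \<bar>r $ i\<bar> \<le> B} \<subseteq> word_ball S C"
    by (rule finite_subset_word_ball[OF finite symmetric generating finite_bounded_int_vecs])
  have "w \<in> word_ball S (n + C)" if w: "real_vec w \<in> (*\<^sub>R) (real n) ` Q" for n w
  proof -
    obtain y where y: "y \<in> Q" "real_vec w = real n *\<^sub>R y" using w by blast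
    from y(1) obtain u where u: "\<forall>x\<in>real_vec ` S. 0 \<le> u x" "sum u (real_vec ` S) = 1"
      "(\<Sum>x\<in>real_vec ` S. u x *\<^sub>R x) = y"
      unfolding Q_def convex_hull_finite[OF finite_imageI[OF finite]] by blast
    \<comment> \<open>The scaled weights sum to n, so their integer parts describe a word
      \<open>?v\<close> of length at most n.\<close>
    define l where "l a = real n * u (real_vec a)" for a
    define k where "k a = nat \<lfloor>l a\<rfloor>" for a
    have inj: "inj_on real_vec S" using inj_real_vec by (rule inj_on_subset) simp
    have l0: "l a \<ge> 0" if "a \<in> S" for a using u(1) that by (simp add: l_def)
    have suml: "(\<Sum>a\<in>S. l a) = real n"
      using u(2) inj by (simp add: l_def sum.reindex flip: sum_distrib_left)
    have w_eq: "real_vec w = (\<Sum>a\<in>S. l a *\<^sub>R real_vec a)"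
      using inj by (simp add: y(2) l_def sum.reindex scaleR_sum_right flip: u(3))
    have k: "real (k a) \<le> l a" "l a - real (k a) \<le> 1" if "a \<in> S" for a
      using l0[OF that] unfolding k_def by linarith+
    let ?v = "\<Sum>a\<in>S. of_nat (k a) * a"
    have "real (\<Sum>a\<in>S. k a) \<le> real n"
      unfolding suml[symmetric] of_nat_sum using k by (intro sum_mono) auto
    then have kn: "(\<Sum>a\<in>S. k a) \<le> n" by linarith
    have "\<bar>(w - ?v) $ i\<bar> \<le> B" for i
    proof -
      have "real_vec (w - ?v) = (\<Sum>a\<in>S. (l a - real (k a)) *\<^sub>R real_vec a)"
        by (simp add: w_eq real_vec_sum scaleR_left_diff_distrib sum_subtractf)
      then have "real_of_int ((w - ?v) $ i) = (\<Sum>a\<in>S. (l a - real (k a)) * real_of_int (a $ i))"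
        by (simp add: real_vec_def vec_eq_iff)
      also have "\<bar>\<dots>\<bar> \<le> (\<Sum>a\<in>S. real_of_int (\<Sum>i\<in>UNIV. \<bar>a $ i\<bar>))"
      proof (rule order_trans[OF sum_abs sum_mono])
        fix a assume a: "a \<in> S"
        have "\<bar>(l a - real (k a)) * real_of_int (a $ i)\<bar> \<le> 1 * real_of_int \<bar>a $ i\<bar>"
          unfolding abs_mult using k[OF a] by (intro mult_mono) auto
        also have "\<bar>a $ i\<bar> \<le> (\<Sum>i\<in>UNIV. \<bar>a $ i\<bar>)" by (rule member_le_sum) auto
        finally show "\<bar>(l a - real (k a)) * real_of_int (a $ i)\<bar>
            \<le> real_of_int (\<Sum>i\<in>UNIV. \<bar>a $ i\<bar>)" by simp
      qed
      finally show ?thesis unfolding B_def of_int_sum[symmetric] by linarith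
    qed
    then have "w - ?v \<in> word_ball S C" using C by blast
    moreover have "?v \<in> word_ball S n"
      using word_ball_sum_multiples[OF finite symmetric generating subset_refl] kn
        word_ball_mono[OF finite symmetric generating kn] by blast
    ultimately have "?v + (w - ?v) \<in> word_ball S (n + C)"
      by (intro word_ball_add[OF finite symmetric generating])
    then show ?thesis by simp
  qed
  then show thesis using that by blast
qed

text \<open>All signed unit vectors have length at most some \<open>C\<close>, so they lie in the
  dilate of \<open>Q\<close> by \<open>C\<close>. Adding one multiple per coordinate gives c = d
  C.\<close>

lemma cube_subset:
  obtains c :: nat where "\<And>x. (\<And>i. \<bar>x $ i\<bar> \<le> 1) \<Longrightarrow> x \<in> (*\<^sub>R) (real c) ` Q"
proof -
  obtain C where C: "range (\<lambda>i. axis i 1) \<union> range (\<lambda>i. - axis i 1) \<subseteq> word_ball S C"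
    by (rule finite_subset_word_ball[OF finite symmetric generating,
          of "range (\<lambda>i. axis i 1) \<union> range (\<lambda>i. - axis i 1)"]) auto
  have "x \<in> (*\<^sub>R) (real (CARD('d) * C)) ` Q" if x: "\<And>i. \<bar>x $ i\<bar> \<le> 1" for x
  proof -
    have "x $ i *\<^sub>R axis i 1 \<in> (*\<^sub>R) (real C) ` Q" for i
    proof -
      have "real_vec (axis i 1) = axis i 1" by (simp add: real_vec_def axis_def vec_eq_iff)
      moreover have "real_vec (axis i 1) \<in> (*\<^sub>R) (real C) ` Q"
        "real_vec (- axis i 1) \<in> (*\<^sub>R) (real C) ` Q"
        using C by (intro word_ball_subset; blast)+
      moreover have "convex ((*\<^sub>R) (real C) ` Q)" using convex_Q by (rule convex_scaling)
      \<comment> \<open>The weights are nonnegative because the coordinate has absolute value at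
        most 1.\<close>
      ultimately have "((1 + x $ i) / 2) *\<^sub>R axis i 1 + ((1 - x $ i) / 2) *\<^sub>R (- axis i 1)
          \<in> (*\<^sub>R) (real C) ` Q"
        using x[of i] by (intro convexD) (auto simp: field_simps)
      then show ?thesis by (simp add: algebra_simps flip: scaleR_left_diff_distrib diff_divide_distrib)
    qed
    then have "(\<Sum>i\<in>UNIV. x $ i *\<^sub>R axis i 1) \<in> (*\<^sub>R) (real CARD('d) * real C) ` Q"
      by (intro scaleR_convex_sum convex_Q zero_in_Q) auto
    moreover have "(\<Sum>i\<in>UNIV. x $ i *\<^sub>R axis i 1) = x"
      using basis_expansion[of x] by (simp add: scalar_mult_eq_scaleR)
    ultimately show ?thesis by simp
  qed
  then show thesis using that by blast
qed

section \<open>Volume bounds for the growth function\<close>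

lemma measure_scaled_Q:
  assumes "t \<ge> 0"
  shows "measure lebesgue ((*\<^sub>R) t ` Q) = t ^ CARD('d) * measure lebesgue Q"
  using measure_lebesgue_affine[of t 0 Q] assms by simp

lemma lmeasurable_scaled_Q: "(*\<^sub>R) t ` Q \<in> lmeasurable"
  using compact_Q by (intro lmeasurable_compact compact_scaling)

text \<open>The disjoint open cubes at the points of the ball have total volume \<beta>(n). A point
  of such a cube is a vector of n Q plus an offset in c Q.\<close>

lemma growth_upper_bound:
  obtains c where "\<And>n. real (growth S n) \<le> measure lebesgue Q * real (n + c) ^ CARD('d)"
proof -
  obtain c :: nat where c: "\<And>x. (\<And>i. \<bar>x $ i\<bar> \<le> 1) \<Longrightarrow> x \<in> (*\<^sub>R) (real c) ` Q"
    by (rule cube_subset) blast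
  have "real (growth S n) \<le> measure lebesgue Q * real (n + c) ^ CARD('d)" for n
  proof -
    let ?F = "\<lambda>w. box (real_vec w) (real_vec w + 1)" and ?W = "word_ball S n"
    note fin = finite_word_ball[OF finite symmetric generating, of n]
    have "disjoint_family_on ?F ?W"
      unfolding disjoint_family_on_def
    proof (intro ballI impI equals0I)
      fix v w x assume "v \<noteq> w" "x \<in> ?F v \<inter> ?F w"
      then obtain i where i: "v $ i \<noteq> w $ i" by (auto simp: vec_eq_iff)
      have "real_of_int (v $ i) < x $ i" "x $ i < real_of_int (v $ i) + 1"
        "real_of_int (w $ i) < x $ i" "x $ i < real_of_int (w $ i) + 1"
        using \<open>x \<in> _\<close> by (auto simp: mem_box_cart real_vec_def)
      then show False using i by linarith
    qed
    then have "measure lebesgue (\<Union>w\<in>?W. ?F w) = (\<Sum>w\<in>?W. measure lebesgue (?F w))"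
      using fin by (intro measure_finite_Union) (auto simp: emeasure_lborel_box_eq)
    then have "real (growth S n) = measure lebesgue (\<Union>w\<in>?W. ?F w)"
      by (simp add: measure_unit_cube growth_def)
    also have "\<dots> \<le> measure lebesgue ((*\<^sub>R) (real n + real c) ` Q)"
    proof (rule measure_mono_fmeasurable[OF _ _ lmeasurable_scaled_Q])
      show "(\<Union>w\<in>?W. ?F w) \<subseteq> (*\<^sub>R) (real n + real c) ` Q"
      proof clarify
        fix w x assume "w \<in> ?W" "x \<in> ?F w"
        have "x - real_vec w \<in> (*\<^sub>R) (real c) ` Q"
          using \<open>x \<in> _\<close> by (intro c) (auto simp: mem_box_cart abs_le_iff algebra_simps less_imp_le)
        with word_ball_subset[OF \<open>w \<in> ?W\<close>]
        have "real_vec w + (x - real_vec w) \<in> (*\<^sub>R) (real n + real c) ` Q"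
          by (intro scaleR_convex_add convex_Q) auto
        then show "x \<in> (*\<^sub>R) (real n + real c) ` Q" by simp
      qed
    qed (auto intro!: sets.finite_UN fin)
    finally show ?thesis by (simp add: measure_scaled_Q mult.commute)
  qed
  then show thesis using that by blast
qed

text \<open>The closed cubes at the points of the ball cover a smaller dilate of \<open>Q\<close>: a
  point of it, rounded down coordinatewise, still has length at most n.\<close>

lemma growth_lower_bound:
  obtains c where "\<And>n. n \<ge> c \<Longrightarrow> measure lebesgue Q * real (n - c) ^ CARD('d) \<le> real (growth S n)"
proof -
  obtain c :: nat where c: "\<And>x. (\<And>i. \<bar>x $ i\<bar> \<le> 1) \<Longrightarrow> x \<in> (*\<^sub>R) (real c) ` Q"
    by (rule cube_subset) blast
  obtain C where C: "\<And>n w. real_vec w \<in> (*\<^sub>R) (real n) ` Q \<Longrightarrow> w \<in> word_ball S (n + C)"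
    by (rule lattice_points_subset) blast
  \<comment> \<open>The loss is \<open>c\<close> for rounding to the lattice and \<open>C\<close>
    for the excess of word length over dilation factor.\<close>
  have "measure lebesgue Q * real (n - (c + C)) ^ CARD('d) \<le> real (growth S n)"
    if n: "n \<ge> c + C" for n
  proof -
    let ?F = "\<lambda>w. cbox (real_vec w) (real_vec w + 1)" and ?W = "word_ball S n"
    note fin = finite_word_ball[OF finite symmetric generating, of n]
    have "measure lebesgue Q * real (n - (c + C)) ^ CARD('d)
        = measure lebesgue ((*\<^sub>R) (real (n - (c + C))) ` Q)"
      by (simp add: measure_scaled_Q mult.commute)
    also have "\<dots> \<le> measure lebesgue (\<Union>w\<in>?W. ?F w)"
    proof (rule measure_mono_fmeasurable)
      show "(*\<^sub>R) (real (n - (c + C))) ` Q \<subseteq> (\<Union>w\<in>?W. ?F w)"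
      proof
        fix x assume x: "x \<in> (*\<^sub>R) (real (n - (c + C))) ` Q"
        define w :: "int ^ 'd" where "w = (\<chi> i. \<lfloor>x $ i\<rfloor>)"
        have "\<bar>(real_vec w - x) $ i\<bar> \<le> 1" for i
          by (simp add: w_def real_vec_def) linarith
        then have "real_vec w - x \<in> (*\<^sub>R) (real c) ` Q" by (rule c)
        with x have "x + (real_vec w - x) \<in> (*\<^sub>R) (real (n - (c + C)) + real c) ` Q"
          by (intro scaleR_convex_add convex_Q) auto
        then have "real_vec w \<in> (*\<^sub>R) (real (n - C)) ` Q"
          using n by (simp add: of_nat_diff)
        then have "w \<in> word_ball S (n - C + C)" by (rule C)
        then have "w \<in> ?W" using n by simp
        moreover have "x \<in> ?F w"
          by (auto simp: mem_box_cart w_def real_vec_def)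
        ultimately show "x \<in> (\<Union>w\<in>?W. ?F w)" by blast
      qed
      show "(*\<^sub>R) (real (n - (c + C))) ` Q \<in> sets lebesgue"
        using lmeasurable_scaled_Q by (rule fmeasurableD)
      show "(\<Union>w\<in>?W. ?F w) \<in> lmeasurable"
        using fin by (intro fmeasurable.finite_UN) auto
    qed
    also have "\<dots> \<le> (\<Sum>w\<in>?W. measure lebesgue (?F w))"
      using fin by (intro measure_UNION_le) auto
    also have "\<dots> = real (growth S n)" by (simp add: measure_unit_cube growth_def)
    finally show ?thesis .
  qed
  then show thesis using that by blast
qed

end

section \<open>The two asymptotic expansions\<close>

theorem theorem1p4:
  fixes S :: "(int ^ 'd::finite) set"
    and Q :: "(real ^ 'd) set"
    and V :: real
  assumes "finite S"
    and "symmetric S"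
    and "generating S"
  defines "Q \<equiv> convex hull (real_vec ` S)"
    and "V \<equiv> measure lebesgue Q"
  shows "(\<lambda>n. real (growth S n) - V * real n ^ CARD('d))
           \<in> O(\<lambda>n. real n powi (int CARD('d) - 1))
       \<and> (\<lambda>n. real (spherical_growth S n) - (real CARD('d) * V) * real n powi (int CARD('d) - 1))
           \<in> O(\<lambda>n. real n powi (int CARD('d) - 2))"
proof -
  let ?d = "CARD('d)"
  have Q: "Q = convex hull (real_vec ` S)" and V: "V = measure lebesgue Q"
    by (simp_all add: Q_def V_def)
  obtain b where b: "\<And>n. real (growth S n) \<le> V * real (n + b) ^ ?d"
    using growth_upper_bound[OF assms(1-3)] unfolding V Q by metis
  obtain a where a: "\<And>n. n \<ge> a \<Longrightarrow> V * real (n - a) ^ ?d \<le> real (growth S n)"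
    using growth_lower_bound[OF assms(1-3)] unfolding V Q by metis
  have growth: "(\<lambda>n. real (growth S n) - V * real n ^ ?d) \<in> O(\<lambda>n. real n powi (int ?d - 1))"
    using a b by (rule bigo_squeeze_shifted_powers)
  have "(\<lambda>n. real (growth S n) - real (growth S (n - 1)) - real ?d * V * real n powi (int ?d - 1))
      \<in> O(\<lambda>n. real n powi (int ?d - 2))"
    using eventually_poly_growth[OF assms(1-3)] _ growth
    by (rule eventually_poly_difference_bigo) simp
  \<comment> \<open>Spherical growth equals the difference of growth values only from n = 1 on,
    which is enough for an asymptotic bound.\<close>
  then have "(\<lambda>n. real (spherical_growth S n) - (real ?d * V) * real n powi (int ?d - 1))
      \<in> O(\<lambda>n. real n powi (int ?d - 2))"
    by (rule landau_o.big.in_cong[THEN iffD1, rotated])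
      (auto intro!: eventually_sequentiallyI[of 1] simp: spherical_growth_eq[OF assms(1-3)])
  with growth show ?thesis by blast
qed

end
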